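(* Let $k\ge2$ be such that $r=2^k-1$ is prime, and let $q=2^k$. Then the integer group determinants of $GA(1,q)$ are exactly the integers of the form $$D=AB^{q-1},\qquad A,B\in\mathbb Z,$$ where either $r\nmid A$ or $r^2\mid A$, and $B\equiv A\pmod q$.
   Context: For a finite group $G=\{g_1,\dots,g_n\}$ and an element $\sum_{g\in G}a_g g$ of the group ring $\mathbb Z[G]$ (all $a_g\in\mathbb Z$), the group determinant is $D\left(\sum_{g\in G}a_g g\right)=\det\left(a_{g_ig_j^{-1}}\right)_{i,j=1}^n$. An integer group determinant of $G$ is any integer of this form. The general affine group of degree one over $\mathbb F_q$ is $GA(1,q)=\left\{\begin{pmatrix} a & b\\ 0 & 1\end{pmatrix}: a\in\mathbb F_q^*,\ b\in\mathbb F_q\right\}$ under matrix multiplication. *)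

theory Defs
  imports "HOL-Combinatorics.Permutations" "HOL-Computational_Algebra.Primes"
     "HOL-Number_Theory.Cong"
begin

text \<open>Group determinant of a finite group given by a carrier set G, multiplication
  and inversion: the determinant of the matrix (x(g h^-1))_{g,h in G}, written via
  the Leibniz formula (independent of the ordering of G).\<close>
definition group_det ::
  "'g set \<Rightarrow> ('g \<Rightarrow> 'g \<Rightarrow> 'g) \<Rightarrow> ('g \<Rightarrow> 'g) \<Rightarrow> ('g \<Rightarrow> int) \<Rightarrow> int" where
  "group_det G mul iv x =
     (\<Sum>\<sigma>\<in>{\<sigma>. \<sigma> permutes G}. of_int (sign \<sigma>) * (\<Prod>g\<in>G. x (mul g (iv (\<sigma> g)))))"

text \<open>GA(1,F): the element (a,b) stands for the matrix [[a,b],[0,1]] with a nonzero.\<close>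
definition ga_carrier :: "('a::field \<times> 'a) set" where
  "ga_carrier = {(a, b). a \<noteq> 0}"

definition ga_mult :: "('a::field \<times> 'a) \<Rightarrow> ('a \<times> 'a) \<Rightarrow> ('a \<times> 'a)" where
  "ga_mult p p' = (fst p * fst p', fst p * snd p' + snd p)"

definition ga_inv :: "('a::field \<times> 'a) \<Rightarrow> ('a \<times> 'a)" where
  "ga_inv p = (inverse (fst p), - (inverse (fst p) * snd p))"

definition ga_int_group_dets :: "'a::{finite,field} itself \<Rightarrow> int set" where
  "ga_int_group_dets _ =
     {D. \<exists>x :: ('a \<times> 'a) \<Rightarrow> int. D = group_det (ga_carrier :: ('a \<times> 'a) set) ga_mult ga_inv x}"

end

theory Submission
  imports Defs "Jordan_Normal_Form.Determinant" "HOL-Number_Theory.Residues"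
begin

text \<open>Fix a nontrivial additive character \<open>\<psi>\<close> of \<open>F\<^sub>q\<close>, with values \<open>1\<close> and \<open>-1\<close>. Restricted to the
  translation subgroup, the group matrix is diagonalised by the characters \<open>b \<mapsto> \<psi> (b t)\<close>,
  which splits the determinant into a circulant determinant \<open>A\<close> of the cyclic group \<open>F\<^sub>q\<^sup>*\<close>
  of order \<open>r\<close> (for \<open>t = 0\<close>) and \<open>q - 1\<close> copies of a determinant \<open>B\<close> (for \<open>t \<noteq> 0\<close>).
  Orthogonality of characters gives \<open>A + (q - 1) B \<equiv> 0\<close> modulo \<open>q\<close>. Modulo \<open>r\<close>, the
  circulant determinant is the row sum \<open>s\<close>, and \<open>r dvd s\<close> forces \<open>r\<^sup>2 dvd A\<close>.

  Conversely, every admissible \<open>A\<close> is the determinant of an integer circulant \<open>C\<close> for which some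
  rank one matrix \<open>u e\<^sub>j\<^sup>T\<close> satisfies \<open>det (C + w u e\<^sub>j\<^sup>T) = A + w\<close>; by Fourier inversion
  every such perturbation with \<open>q dvd w\<close> can be prescribed for \<open>B\<close> while keeping \<open>A\<close>.\<close>

section \<open>Determinants over finite index sets\<close>

text \<open>The index set is unordered, so rows can be indexed by \<open>nz\<close>, by pairs or by
  exponents, and \<open>group_det\<close> unfolds to this form directly.\<close>

definition set_det :: "'i set \<Rightarrow> ('i \<Rightarrow> 'i \<Rightarrow> int) \<Rightarrow> int" where
  "set_det S M = (\<Sum>\<sigma> | \<sigma> permutes S. sign \<sigma> * (\<Prod>i\<in>S. M i (\<sigma> i)))"

lemma set_det_cong:
  assumes "\<And>i j. i \<in> S \<Longrightarrow> j \<in> S \<Longrightarrow> M i j = N i j"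
  shows "set_det S M = set_det S N"
  unfolding set_det_def
  by (intro sum.cong arg_cong2[where f = "(*)"] prod.cong refl assms)
     (auto simp: permutes_in_image)

lemma bij_betw_map_permutation:
  assumes "bij_betw f S T"
  shows "bij_betw (map_permutation S f) {\<sigma>. \<sigma> permutes S} {\<sigma>. \<sigma> permutes T}"
proof -
  let ?g = "inv_into S f"
  have g: "bij_betw ?g T S" using assms by (rule bij_betw_inv_into)
  show ?thesis
  proof (rule bij_betwI[where g = "map_permutation T ?g"])
    show "map_permutation T ?g (map_permutation S f \<sigma>) = \<sigma>" if "\<sigma> \<in> {\<sigma>. \<sigma> permutes S}" for \<sigma>
      using that assms map_permutation_compose_inv[OF assms, of \<sigma> ?g]
      by (simp add: bij_betw_inv_into_left)
    show "map_permutation S f (map_permutation T ?g \<sigma>) = \<sigma>" if "\<sigma> \<in> {\<sigma>. \<sigma> permutes T}" for \<sigma>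
      using that assms map_permutation_compose_inv[OF g, of \<sigma> f]
      by (simp add: bij_betw_inv_into_right)
  qed (use map_permutation_permutes[OF assms] map_permutation_permutes[OF g] in auto)
qed

lemma set_det_reindex:
  assumes "bij_betw f S T" "finite S"
  shows "set_det T M = set_det S (\<lambda>i j. M (f i) (f j))"
proof -
  have inj: "inj_on f S" using assms by (simp add: bij_betw_def)
  have "set_det T M = (\<Sum>\<sigma> | \<sigma> permutes S. sign (map_permutation S f \<sigma>) *
      (\<Prod>i\<in>T. M i (map_permutation S f \<sigma> i)))"
    unfolding set_det_def
    by (rule sum.reindex_bij_betw[OF bij_betw_map_permutation[OF assms(1)], symmetric])
  also have "\<dots> = set_det S (\<lambda>i j. M (f i) (f j))"
    unfolding set_det_def
  proof (intro sum.cong refl arg_cong2[where f = "(*)"])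
    fix \<sigma> assume "\<sigma> \<in> {\<sigma>. \<sigma> permutes S}"
    then have \<sigma>: "\<sigma> permutes S" by simp
    show "sign (map_permutation S f \<sigma>) = sign \<sigma>"
      by (rule sign_map_permutation) (use assms inj \<sigma> in auto)
    have "(\<Prod>i\<in>T. M i (map_permutation S f \<sigma> i)) = (\<Prod>i\<in>S. M (f i) (map_permutation S f \<sigma> (f i)))"
      by (rule prod.reindex_bij_betw[OF assms(1), symmetric])
    then show "(\<Prod>i\<in>T. M i (map_permutation S f \<sigma> i)) = (\<Prod>i\<in>S. M (f i) (f (\<sigma> i)))"
      by (simp add: map_permutation_apply[OF inj])
  qed
  finally show ?thesis .
qed

lemma set_det_eq_det: "set_det {0..<n} M = det (mat n n (\<lambda>(i, j). M i j))"
  unfolding set_det_def det_def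
  by (auto intro!: sum.cong prod.cong simp: sign_def permutes_in_image)

lemma set_det_mult:
  assumes "finite S"
  shows "set_det S (\<lambda>i j. \<Sum>k\<in>S. M i k * N k j) = set_det S M * set_det S N"
proof -
  obtain f where f: "bij_betw f {0..<card S} S"
    using assms ex_bij_betw_nat_finite by blast
  let ?n = "card S"
  let ?M = "mat ?n ?n (\<lambda>(i, j). M (f i) (f j))" and ?N = "mat ?n ?n (\<lambda>(i, j). N (f i) (f j))"
  have "set_det S (\<lambda>i j. \<Sum>k\<in>S. M i k * N k j) =
      set_det {0..<?n} (\<lambda>i j. \<Sum>k\<in>{0..<?n}. M (f i) (f k) * N (f k) (f j))"
    by (simp add: set_det_reindex[OF f] sum.reindex_bij_betw[OF f, symmetric])
  also have "\<dots> = det (?M * ?N)"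
    unfolding set_det_eq_det
    by (intro arg_cong[where f = det] eq_matI) (auto simp: scalar_prod_def)
  also have "\<dots> = det ?M * det ?N"
    by (rule det_mult) auto
  also have "\<dots> = set_det S M * set_det S N"
    by (simp add: set_det_reindex[OF f] set_det_eq_det)
  finally show ?thesis .
qed

section \<open>Row expansion, triangular and block matrices, rank one updates\<close>

lemma set_det_empty [simp]: "set_det {} M = 1"
  by (simp add: set_det_def)

text \<open>Expansion along row \<open>a\<close>: a permutation that moves \<open>a\<close> sends it
  into \<open>S\<close> and so picks a zero entry of that row.\<close>

lemma set_det_insert:
  assumes "finite S" "a \<notin> S" "\<And>j. j \<in> S \<Longrightarrow> M a j = 0"
  shows "set_det (insert a S) M = M a a * set_det S M"
proof -
  let ?t = "\<lambda>\<sigma>. sign \<sigma> * (\<Prod>i\<in>insert a S. M i (\<sigma> i))"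
  have "set_det (insert a S) M = sum ?t {\<sigma>. \<sigma> permutes S}"
    unfolding set_det_def
  proof (rule sum.mono_neutral_right)
    show "finite {\<sigma>. \<sigma> permutes insert a S}" using assms(1) by (simp add: finite_permutations)
    show "{\<sigma>. \<sigma> permutes S} \<subseteq> {\<sigma>. \<sigma> permutes insert a S}"
      by (auto intro: permutes_subset)
    show "\<forall>\<sigma>\<in>{\<sigma>. \<sigma> permutes insert a S} - {\<sigma>. \<sigma> permutes S}. ?t \<sigma> = 0"
    proof
      fix \<sigma> assume "\<sigma> \<in> {\<sigma>. \<sigma> permutes insert a S} - {\<sigma>. \<sigma> permutes S}"
      then have \<sigma>: "\<sigma> permutes insert a S" "\<not> \<sigma> permutes S" by auto
      then have "\<sigma> a \<noteq> a" using permutes_superset[OF \<sigma>(1), of S] by auto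
      then have "\<sigma> a \<in> S" using permutes_in_image[OF \<sigma>(1), of a] by auto
      then show "?t \<sigma> = 0" using assms by simp
    qed
  qed
  also have "\<dots> = (\<Sum>\<sigma> | \<sigma> permutes S. M a a * (sign \<sigma> * (\<Prod>i\<in>S. M i (\<sigma> i))))"
    using assms by (intro sum.cong refl) (auto simp: permutes_not_in algebra_simps)
  also have "\<dots> = M a a * set_det S M"
    by (simp add: set_det_def sum_distrib_left)
  finally show ?thesis .
qed

text \<open>The row of the least element vanishes off the diagonal, so it can be peeled off
  first.\<close>

lemma set_det_lower_triangular:
  fixes S :: "'i::linorder set"
  assumes "finite S" "\<And>i j. i \<in> S \<Longrightarrow> j \<in> S \<Longrightarrow> i < j \<Longrightarrow> M i j = 0"
  shows "set_det S M = (\<Prod>i\<in>S. M i i)"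
  using assms
proof (induction S rule: finite_linorder_min_induct)
  case (insert a S)
  then show ?case by (subst set_det_insert) auto
qed auto

lemma set_det_upper_triangular:
  fixes S :: "'i::linorder set"
  assumes "finite S" "\<And>i j. i \<in> S \<Longrightarrow> j \<in> S \<Longrightarrow> j < i \<Longrightarrow> M i j = 0"
  shows "set_det S M = (\<Prod>i\<in>S. M i i)"
  using assms
proof (induction S rule: finite_linorder_max_induct)
  case (insert a S)
  then show ?case by (subst set_det_insert) auto
qed auto

lemma set_det_diagonal:
  assumes "finite S" "\<And>i j. i \<in> S \<Longrightarrow> j \<in> S \<Longrightarrow> i \<noteq> j \<Longrightarrow> M i j = 0"
  shows "set_det S M = (\<Prod>i\<in>S. M i i)"
  using assms
proof (induction S rule: finite_induct)
  case (insert a S)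
  then show ?case by (subst set_det_insert) auto
qed auto

lemma set_det_identity_off:
  assumes "finite U" "finite V" "U \<inter> V = {}"
    "\<And>i j. i \<in> V \<Longrightarrow> j \<in> U \<union> V \<Longrightarrow> M i j = of_bool (i = j)"
  shows "set_det (U \<union> V) M = set_det U M"
  using assms(2,1,3,4)
proof (induction V rule: finite_induct)
  case (insert a V)
  have "set_det (insert a (U \<union> V)) M = M a a * set_det (U \<union> V) M"
    using insert by (intro set_det_insert) auto
  with insert show ?case by auto
qed auto

text \<open>\<open>M\<close> is the product of two matrices, each keeping the rows of one block and
  having identity rows elsewhere.\<close>

lemma set_det_Un:
  assumes "finite U" "finite V" "U \<inter> V = {}"
    "\<And>i j. i \<in> U \<Longrightarrow> j \<in> V \<Longrightarrow> M i j = 0" "\<And>i j. i \<in> U \<Longrightarrow> j \<in> V \<Longrightarrow> M j i = 0"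
  shows "set_det (U \<union> V) M = set_det U M * set_det V M"
proof -
  define K where "K W i j = (if i \<in> W then M i j else of_bool (i = j))" for W i j
  have "set_det (U \<union> V) M = set_det (U \<union> V) (\<lambda>i j. \<Sum>k\<in>U \<union> V. K U i k * K V k j)"
  proof (rule set_det_cong)
    fix i j assume ij: "i \<in> U \<union> V" "j \<in> U \<union> V"
    show "M i j = (\<Sum>k\<in>U \<union> V. K U i k * K V k j)"
    proof (cases "i \<in> U")
      case True
      then have "(\<Sum>k\<in>U \<union> V. K U i k * K V k j) = (\<Sum>k\<in>U \<union> V. M i k * of_bool (k = j))"
        using assms by (intro sum.cong refl) (auto simp: K_def)
      then show ?thesis using ij assms(1,2) by simp
    next
      case False
      then have "(\<Sum>k\<in>U \<union> V. K U i k * K V k j) = (\<Sum>k\<in>U \<union> V. of_bool (i = k) * M k j)"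
        using ij by (intro sum.cong refl) (auto simp: K_def)
      then show ?thesis using ij assms(1,2) by simp
    qed
  qed
  also have "\<dots> = set_det (U \<union> V) (K U) * set_det (U \<union> V) (K V)"
    using assms by (intro set_det_mult) auto
  also have "set_det (U \<union> V) (K U) = set_det U (K U)"
    using assms by (intro set_det_identity_off) (auto simp: K_def)
  also have "set_det (U \<union> V) (K V) = set_det V (K V)"
    using assms by (subst Un_commute, intro set_det_identity_off) (auto simp: K_def)
  also have "set_det U (K U) = set_det U M"
    by (intro set_det_cong) (auto simp: K_def)
  also have "set_det V (K V) = set_det V M"
    by (intro set_det_cong) (auto simp: K_def)
  finally show ?thesis .
qed

lemma set_det_block_diagonal:
  assumes "finite S" "finite T"
  shows "set_det (S \<times> T) (\<lambda>(i, t) (j, u). if t = u then M t i j else 0) = (\<Prod>t\<in>T. set_det S (M t))"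
  using assms(2)
proof (induction T rule: finite_induct)
  case (insert t T)
  let ?M = "\<lambda>(i, t) (j, u). if t = u then M t i j else 0"
  have "S \<times> insert t T = S \<times> {t} \<union> S \<times> T" by auto
  then have "set_det (S \<times> insert t T) ?M = set_det (S \<times> {t}) ?M * set_det (S \<times> T) ?M"
    by (simp only:) (rule set_det_Un, use insert assms(1) in auto)
  moreover have "set_det (S \<times> {t}) ?M = set_det S (\<lambda>i j. ?M (i, t) (j, t))"
    using assms(1) by (intro set_det_reindex) (auto intro!: bij_betwI[where g = fst])
  ultimately show ?case using insert by simp
qed auto

lemma set_det_scale:
  assumes "finite S"
  shows "set_det S (\<lambda>i j. c * M i j) = c ^ card S * set_det S M"
  unfolding set_det_def by (simp add: prod.distrib sum_distrib_left algebra_simps)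

text \<open>Multiplying the perturbed matrix by \<open>A\<close> turns it into
  \<open>C (A I + w y e\<^sub>j\<^sup>T)\<close>.\<close>

lemma set_det_add_rank_one:
  assumes "finite S" "j \<in> S" "A \<noteq> 0" and C: "set_det S C = A"
    and y: "\<And>i. i \<in> S \<Longrightarrow> (\<Sum>k\<in>S. C i k * y k) = A * u i" "y j = 1"
  shows "set_det S (\<lambda>i k. C i k + w * u i * of_bool (k = j)) = A + w"
proof -
  define n where "n = card (S - {j})"
  have n: "card S = Suc n" unfolding n_def by (rule card.remove[OF assms(1,2)])
  define K where "K i k = A * of_bool (i = k) + w * y i * of_bool (k = j)" for i k
  \<comment> \<open>Row \<open>j\<close> of \<open>K\<close> is zero off the diagonal, and deleting
    row and column \<open>j\<close> leaves \<open>A\<close> times the identity.\<close>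
  have "set_det (insert j (S - {j})) K = K j j * set_det (S - {j}) K"
    using assms(1) by (intro set_det_insert) (auto simp: K_def)
  then have "set_det S K = K j j * set_det (S - {j}) K"
    using assms(2) by (simp add: insert_absorb)
  also have "set_det (S - {j}) K = A ^ n"
    using assms(1) by (subst set_det_diagonal) (auto simp: K_def n_def)
  also have "K j j = A + w" by (simp add: K_def y)
  finally have K: "set_det S K = (A + w) * A ^ n" .
  have "A ^ card S * set_det S (\<lambda>i k. C i k + w * u i * of_bool (k = j)) =
      set_det S (\<lambda>i k. A * (C i k + w * u i * of_bool (k = j)))"
    using assms(1) by (simp add: set_det_scale)
  also have "\<dots> = set_det S (\<lambda>i k. \<Sum>l\<in>S. C i l * K l k)"
  proof (rule set_det_cong)
    fix i k assume ik: "i \<in> S" "k \<in> S"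
    have "(\<Sum>l\<in>S. C i l * K l k) =
        A * (\<Sum>l\<in>S. C i l * of_bool (l = k)) + w * of_bool (k = j) * (\<Sum>l\<in>S. C i l * y l)"
      by (simp only: K_def sum_distrib_left sum.distrib[symmetric]) (simp add: algebra_simps)
    also have "\<dots> = A * (C i k + w * u i * of_bool (k = j))"
      using ik assms(1) y(1)[OF ik(1)] by (simp add: algebra_simps)
    finally show "A * (C i k + w * u i * of_bool (k = j)) = (\<Sum>l\<in>S. C i l * K l k)" by simp
  qed
  also have "\<dots> = A ^ card S * (A + w)"
    using assms(1) by (simp add: set_det_mult C K n)
  finally show ?thesis using assms(3) by simp
qed

section \<open>Circulant determinants modulo a prime\<close>

lemma funpow_fixed_mult:
  assumes "(f ^^ d) t = t"
  shows "(f ^^ (d * n)) t = t"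
  by (induction n) (simp_all add: funpow_add assms)

lemma funpow_fixed_coprime:
  assumes "(f ^^ d) t = t" "(f ^^ r) t = t" "coprime d r" "d \<noteq> 0"
  shows "f t = t"
proof -
  obtain x y where "d * x = r * y + 1"
    using bezout_nat[OF assms(4), of r] assms(3) by auto
  then have "(f ^^ (d * x)) t = f ((f ^^ (r * y)) t)" by simp
  then show ?thesis using assms(1,2) by (simp add: funpow_fixed_mult)
qed

text \<open>Since \<open>r\<close> is prime, an orbit that is not a single point has exactly
  \<open>r\<close> elements; \<open>w\<close> is constant on it, so it contributes a multiple of
  \<open>r\<close>. Such orbits are removed one at a time.\<close>

lemma sum_cong_sum_fixed_points:
  fixes w :: "'t \<Rightarrow> int"
  assumes "prime r" "finite T"
    and "\<And>t. t \<in> T \<Longrightarrow> \<phi> t \<in> T" "\<And>t. t \<in> T \<Longrightarrow> (\<phi> ^^ r) t = t" "\<And>t. t \<in> T \<Longrightarrow> w (\<phi> t) = w t"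
  shows "[sum w T = sum w {t \<in> T. \<phi> t = t}] (mod int r)"
  using assms(2-)
proof (induction T rule: finite_psubset_induct)
  case (psubset T)
  have r: "r > 0" using assms(1) prime_gt_0_nat by blast
  show ?case
  proof (cases "\<forall>t\<in>T. \<phi> t = t")
    case True
    then have "{t \<in> T. \<phi> t = t} = T" by auto
    then show ?thesis by simp
  next
    case False
    then obtain t where t: "t \<in> T" "\<phi> t \<noteq> t" by auto
    have per: "(\<phi> ^^ r) t = t" using psubset.prems t by simp
    have it: "(\<phi> ^^ i) t \<in> T \<and> w ((\<phi> ^^ i) t) = w t" for i
      by (induction i) (use psubset.prems t in auto)
    define Orb where "Orb = (\<lambda>i. (\<phi> ^^ i) t) ` {..<r}"
    have sub: "Orb \<subseteq> T" using it by (auto simp: Orb_def)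
    have return: "(\<phi> ^^ (r - i)) ((\<phi> ^^ i) t) = t" if "i < r" for i
    proof -
      have "(\<phi> ^^ (r - i)) ((\<phi> ^^ i) t) = (\<phi> ^^ (r - i + i)) t" by (simp only: funpow_add o_apply)
      then show ?thesis using that per by simp
    qed
    have ne: "(\<phi> ^^ i) t \<noteq> (\<phi> ^^ j) t" if "i < j" "j < r" for i j
    proof
      assume eq: "(\<phi> ^^ i) t = (\<phi> ^^ j) t"
      have "(\<phi> ^^ (r - i)) ((\<phi> ^^ i) t) = (\<phi> ^^ (r - i + j)) t"
        by (simp only: eq funpow_add o_apply)
      moreover have "r - i + j = (j - i) + r" using that by simp
      ultimately have "(\<phi> ^^ (j - i)) t = t"
        using return[of i] that per by (simp only: funpow_add o_apply)
      moreover have "coprime (j - i) r"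
        using that assms(1) by (intro coprime_commute[THEN iffD1, OF prime_imp_coprime]) (auto dest: dvd_imp_le)
      ultimately show False using funpow_fixed_coprime[of "j - i" \<phi> t r] per t that by auto
    qed
    have inj: "inj_on (\<lambda>i. (\<phi> ^^ i) t) {..<r}"
    proof (rule inj_onI)
      fix i j assume "i \<in> {..<r}" "j \<in> {..<r}" "(\<phi> ^^ i) t = (\<phi> ^^ j) t"
      then show "i = j" using ne[of i j] ne[of j i] by (cases i j rule: linorder_cases) auto
    qed
    have "sum w Orb = (\<Sum>i<r. w t)"
      unfolding Orb_def by (subst sum.reindex[OF inj]) (use it in auto)
    then have so: "sum w Orb = int r * w t" by simp
    have closed: "(\<phi> ^^ n) t \<in> Orb" for n
    proof -
      have "(\<phi> ^^ n) t = (\<phi> ^^ (n mod r + r * (n div r))) t" by simp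
      also have "\<dots> = (\<phi> ^^ (n mod r)) t"
        using per by (simp only: funpow_add o_apply funpow_fixed_mult)
      finally show ?thesis using r by (auto simp: Orb_def)
    qed
    have nofix: "\<phi> s \<noteq> s" if mem: "s \<in> Orb" for s
    proof
      assume s: "\<phi> s = s"
      obtain i where i: "i < r" "s = (\<phi> ^^ i) t" using mem unfolding Orb_def by blast
      have "(\<phi> ^^ n) s = s" for n by (induction n) (simp_all add: s)
      then have "t = s" using return[OF i(1)] i(2) by simp
      then show False using s t by simp
    qed
    have stable: "\<phi> s \<in> T - Orb" if s: "s \<in> T - Orb" for s
    proof -
      have "\<phi> s \<notin> Orb"
      proof
        assume "\<phi> s \<in> Orb"
        then obtain i where i: "\<phi> s = (\<phi> ^^ i) t" by (auto simp: Orb_def)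
        \<comment> \<open>The power \<open>r - 1\<close> of \<open>\<phi>\<close> inverts
          \<open>\<phi>\<close> on \<open>T\<close>, so a point whose image lies in the orbit lies
          there itself.\<close>
        have "s = (\<phi> ^^ (r - 1 + 1)) s" using psubset.prems s r by simp
        also have "\<dots> = (\<phi> ^^ (r - 1)) (\<phi> s)" by (simp only: funpow_add o_apply) simp
        also have "\<dots> = (\<phi> ^^ (r - 1 + i)) t" by (simp only: funpow_add o_apply i)
        finally show False using closed s by auto
      qed
      then show ?thesis using psubset.prems s by auto
    qed
    have "t \<in> Orb" using r by (auto simp: Orb_def intro!: image_eqI[of _ _ 0])
    then have "[sum w (T - Orb) = sum w {s \<in> T - Orb. \<phi> s = s}] (mod int r)"
      using psubset.prems stable t by (intro psubset.IH) auto
    moreover have "{s \<in> T - Orb. \<phi> s = s} = {s \<in> T. \<phi> s = s}" using nofix by auto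
    moreover have "sum w T = int r * w t + sum w (T - Orb)"
      using sum.subset_diff[OF sub psubset.hyps(1), of w] so by simp
    ultimately show ?thesis by (simp add: cong_def)
  qed
qed

lemma int_power_prime_cong:
  assumes "prime r"
  shows "[x ^ r = x] (mod int r)"
proof (cases "int r dvd x")
  case True
  then have "int r dvd x ^ r"
    using assms by (metis dvd_power dvd_trans prime_gt_0_nat)
  then show ?thesis using True by (simp add: cong_iff_dvd_diff)
next
  case False
  define y where "y = nat (x mod int r)"
  have r: "r > 0" using assms prime_gt_0_nat by blast
  have y: "int y = x mod int r" using r by (simp add: y_def)
  have "\<not> r dvd y"
    using False y by (metis dvd_mod_iff int_dvd_int_iff dvd_refl)
  then have "[y ^ (r - 1) = 1] (mod r)" using assms fermat_theorem by blast
  then have "[y ^ (r - 1) * y = 1 * y] (mod r)" by (rule cong_mult) simp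
  then have "[y ^ r = y] (mod r)" by (simp only: power_minus_mult[OF r] mult_1_left)
  then have "[int y ^ r = int y] (mod int r)"
    by (metis cong_int_iff of_nat_power)
  moreover have "[x = int y] (mod int r)" by (simp add: y cong_def)
  ultimately show ?thesis by (meson cong_pow cong_sym cong_trans)
qed

section \<open>The multiplicative group of a finite field and its translations\<close>

abbreviation nz :: "'a::zero set" where "nz \<equiv> {a. a \<noteq> 0}"

lemma bij_betw_mult_nz:
  fixes e :: "'a::field"
  assumes "e \<noteq> 0"
  shows "bij_betw ((*) e) nz nz"
  by (rule bij_betwI[where g = "\<lambda>a. a / e"]) (use assms in auto)

text \<open>Multiplication by \<open>e\<close> permutes the nonzero elements, so their product is
  unchanged when each gains a factor \<open>e\<close>.\<close>

lemma power_card_nz: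
  fixes e :: "'a::{field,finite}"
  assumes "e \<noteq> 0"
  shows "e ^ card (nz :: 'a set) = 1"
proof -
  have "(\<Prod>a\<in>nz. e * a) = \<Prod>(nz :: 'a set)"
    using prod.reindex_bij_betw[OF bij_betw_mult_nz[OF assms], of "\<lambda>a. a"] by simp
  moreover have "\<Prod>(nz :: 'a set) \<noteq> 0" by simp
  ultimately show ?thesis by (simp add: prod.distrib)
qed

text \<open>In a group of prime order every element other than 1 is a generator.\<close>

lemma bij_betw_power_nz:
  fixes e :: "'a::{field,finite}"
  assumes "prime (card (nz :: 'a set))" "e \<noteq> 0" "e \<noteq> 1"
  shows "bij_betw (\<lambda>i. e ^ i) {..<card (nz :: 'a set)} (nz :: 'a set)"
proof -
  let ?r = "card (nz :: 'a set)"
  have ne: "e ^ i \<noteq> e ^ j" if "i < j" "j < ?r" for i j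
  proof
    assume "e ^ i = e ^ j"
    also have "e ^ j = e ^ i * e ^ (j - i)" using that by (simp flip: power_add)
    finally have 1: "e ^ (j - i) = 1" using assms by simp
    have pow: "((*) e ^^ n) 1 = e ^ n" for n by (induction n) auto
    have "coprime (j - i) ?r"
      using that assms(1) by (intro coprime_commute[THEN iffD1, OF prime_imp_coprime]) (auto dest: dvd_imp_le)
    then have "e * 1 = 1"
      using funpow_fixed_coprime[of "j - i" "(*) e" 1 ?r] that 1 power_card_nz[OF assms(2)]
      by (simp only: pow)
    then show False using assms by simp
  qed
  have inj: "inj_on (\<lambda>i. e ^ i) {..<?r}"
  proof (rule inj_onI)
    fix i j assume "i \<in> {..<?r}" "j \<in> {..<?r}" "e ^ i = e ^ j"
    then show "i = j" using ne[of i j] ne[of j i] by (cases i j rule: linorder_cases) auto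
  qed
  moreover have "(\<lambda>i. e ^ i) ` {..<?r} = nz"
    by (rule card_subset_eq) (use assms card_image[OF inj] in auto)
  ultimately show ?thesis by (simp add: bij_betw_def)
qed

lemma permutes_mult_nz:
  fixes e :: "'a::field"
  assumes "e \<noteq> 0"
  shows "(*) e permutes nz"
  by (rule bij_imp_permutes[OF bij_betw_mult_nz[OF assms]]) auto

text \<open>The sign is multiplicative in \<open>e\<close>, and \<open>e\<close> to the odd power
  \<open>card nz\<close> is 1, so an odd power of the sign is 1.\<close>

lemma sign_mult_nz:
  fixes e :: "'a::{field,finite}"
  assumes "odd (card (nz :: 'a set))" "e \<noteq> 0"
  shows "sign ((*) e) = 1"
proof -
  have id: "(*) (1 :: 'a) = id" by auto
  have perm: "permutation ((*) d)" if "d \<noteq> 0" for d :: 'a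
    using permutes_imp_permutation[OF _ permutes_mult_nz[OF that]] by simp
  have "sign ((*) (e ^ n)) = sign ((*) e) ^ n" for n
  proof (induction n)
    case (Suc n)
    have "(*) (e ^ Suc n) = (*) e \<circ> (*) (e ^ n)" by (auto simp: mult.assoc)
    then have "sign ((*) (e ^ Suc n)) = sign ((*) e) * sign ((*) (e ^ n))"
      using assms sign_compose[OF perm perm, of e "e ^ n"] by simp
    then show ?case by (simp only: Suc power_Suc)
  qed (simp add: id)
  from this[of "card (nz :: 'a set)"]
  have "sign ((*) e) ^ card (nz :: 'a set) = 1"
    by (simp add: power_card_nz[OF assms(2)] id)
  then show ?thesis using assms(1) by (auto simp: sign_def split: if_splits)
qed

text \<open>Translations of the cyclic group act on the Leibniz terms by conjugation; the fixed
  permutations are the translations, which contribute \<open>f (1/e) ^ r\<close>.\<close>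

lemma set_det_circulant_cong:
  fixes f :: "'a::{field,finite} \<Rightarrow> int"
  defines "r \<equiv> card (nz :: 'a set)"
  assumes r: "prime r" "odd r"
  shows "[set_det nz (\<lambda>a c. f (a / c)) = sum f nz] (mod int r)"
proof -
  have "card (nz :: 'a set) \<noteq> card {1 :: 'a}" using r not_prime_1 unfolding r_def by auto
  then have "nz \<noteq> {1 :: 'a}" by metis
  then obtain g :: 'a where g: "g \<noteq> 0" "g \<noteq> 1" by auto
  define \<phi> where "\<phi> \<sigma> = (*) g \<circ> \<sigma> \<circ> (*) (inverse g)" for \<sigma> :: "'a \<Rightarrow> 'a"
  define w where "w \<sigma> = sign \<sigma> * (\<Prod>a\<in>nz. f (a / \<sigma> a))" for \<sigma> :: "'a \<Rightarrow> 'a"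
  let ?T = "{\<sigma> :: 'a \<Rightarrow> 'a. \<sigma> permutes nz}"
  have pg: "(*) g permutes nz" "(*) (inverse g) permutes nz"
    using g by (auto intro: permutes_mult_nz)
  have \<phi>T: "\<phi> \<sigma> \<in> ?T" if "\<sigma> \<in> ?T" for \<sigma>
    using that unfolding \<phi>_def by (auto intro!: permutes_compose pg)
  have "(\<phi> ^^ n) \<sigma> = (*) (g ^ n) \<circ> \<sigma> \<circ> (*) (inverse g ^ n)" for n \<sigma>
    by (induction n) (auto simp: \<phi>_def fun_eq_iff ac_simps)
  then have \<phi>r: "(\<phi> ^^ r) \<sigma> = \<sigma>" for \<sigma>
    using g by (simp add: r_def power_card_nz fun_eq_iff)
  have w\<phi>: "w (\<phi> \<sigma>) = w \<sigma>" if "\<sigma> \<in> ?T" for \<sigma>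
  proof -
    have perm: "permutation \<sigma>" "permutation ((*) g)" "permutation ((*) (inverse g))"
      using that pg by (auto intro: permutes_imp_permutation[of nz])
    have "sign (\<phi> \<sigma>) = sign \<sigma>"
      using g r(2) perm by (simp add: \<phi>_def sign_compose permutation_compose sign_mult_nz r_def)
    moreover have "(\<Prod>a\<in>nz. f (a / \<phi> \<sigma> a)) = (\<Prod>a\<in>nz. f (g * a / \<phi> \<sigma> (g * a)))"
      by (rule prod.reindex_bij_betw[OF bij_betw_mult_nz[OF g(1)], symmetric])
    moreover have "g * a / \<phi> \<sigma> (g * a) = a / \<sigma> a" for a
      using g by (simp add: \<phi>_def flip: mult.assoc)
    ultimately show ?thesis by (simp add: w_def)
  qed
  have fixed: "{\<sigma> \<in> ?T. \<phi> \<sigma> = \<sigma>} = (*) ` nz"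
  proof (intro equalityI subsetI)
    fix \<sigma> assume "\<sigma> \<in> {\<sigma> \<in> ?T. \<phi> \<sigma> = \<sigma>}"
    then have \<sigma>: "\<sigma> permutes nz" "\<phi> \<sigma> = \<sigma>" by auto
    \<comment> \<open>A permutation fixed by \<open>\<phi>\<close> commutes with multiplication by
      the generator \<open>g\<close>, so its value at 1 determines it.\<close>
    have "\<sigma> (g * a) = \<phi> \<sigma> (g * a)" for a by (simp add: \<sigma>(2))
    then have step: "\<sigma> (g * a) = g * \<sigma> a" for a
      using g by (simp add: \<phi>_def flip: mult.assoc)
    have pow: "\<sigma> (g ^ n) = \<sigma> 1 * g ^ n" for n
      by (induction n) (simp_all add: step)
    have mult: "\<sigma> a = \<sigma> 1 * a" for a
    proof (cases "a = 0")
      case True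
      then show ?thesis using permutes_not_in[OF \<sigma>(1), of 0] by simp
    next
      case False
      then have "a \<in> (\<lambda>i. g ^ i) ` {..<r}"
        using bij_betw_imp_surj_on[OF bij_betw_power_nz[OF r(1)[unfolded r_def] g]]
        unfolding r_def by blast
      then obtain n where "a = g ^ n" by blast
      then show ?thesis using pow by simp
    qed
    have "\<sigma> = (*) (\<sigma> 1)" using mult by (rule ext)
    moreover have "\<sigma> 1 \<noteq> 0" using permutes_in_image[OF \<sigma>(1), of 1] by simp
    ultimately show "\<sigma> \<in> (*) ` nz"
      by (intro image_eqI[of _ _ "\<sigma> 1"]) auto
  next
    fix \<sigma> :: "'a \<Rightarrow> 'a" assume "\<sigma> \<in> (*) ` nz"
    then obtain e :: 'a where e: "e \<noteq> 0" "\<sigma> = (*) e" by auto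
    then show "\<sigma> \<in> {\<sigma> \<in> ?T. \<phi> \<sigma> = \<sigma>}"
      using g permutes_mult_nz[OF e(1)] by (auto simp: \<phi>_def)
  qed
  have "inj_on ((*) :: 'a \<Rightarrow> 'a \<Rightarrow> 'a) nz"
    by (intro inj_onI) (metis mult.right_neutral)
  then have "sum w ((*) ` nz) = (\<Sum>e\<in>nz. w ((*) e))"
    by (simp add: sum.reindex)
  also have "\<dots> = (\<Sum>e\<in>nz. f (inverse e) ^ r)"
  proof (rule sum.cong[OF refl])
    fix e :: 'a assume e: "e \<in> nz"
    have "(\<Prod>a\<in>nz. f (a / (e * a))) = (\<Prod>a\<in>(nz :: 'a set). f (inverse e))"
      by (rule prod.cong) (use e in \<open>auto simp: divide_simps\<close>)
    then show "w ((*) e) = f (inverse e) ^ r"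
      using e r(2) by (simp add: w_def sign_mult_nz r_def)
  qed
  also have "\<dots> = (\<Sum>e\<in>nz. f e ^ r)"
    by (rule sum.reindex_bij_betw) (auto intro!: bij_betwI[where g = inverse])
  finally have eq: "sum w {\<sigma> \<in> ?T. \<phi> \<sigma> = \<sigma>} = (\<Sum>e\<in>nz. f e ^ r)" by (simp only: fixed)
  have "[sum w ?T = sum w {\<sigma> \<in> ?T. \<phi> \<sigma> = \<sigma>}] (mod int r)"
    by (rule sum_cong_sum_fixed_points[OF r(1)]) (use \<phi>T \<phi>r w\<phi> in \<open>simp_all add: finite_permutations\<close>)
  also have "sum w ?T = set_det nz (\<lambda>a c. f (a / c))" by (simp add: w_def set_det_def)
  also note eq
  also have "[(\<Sum>e\<in>nz. f e ^ r) = sum f nz] (mod int r)"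
    by (intro cong_sum int_power_prime_cong r)
  finally show ?thesis .
qed

text \<open>Adding all columns to column \<open>j\<close> and then all rows to row \<open>j\<close> leaves entries divisible
  by \<open>p\<close> in row and column \<open>j\<close>, and an entry divisible by \<open>p\<^sup>2\<close> where they meet.\<close>

lemma square_dvd_set_det:
  assumes "finite S" "S \<noteq> {}" "p dvd int (card S)" "p dvd s"
    and row: "\<And>i. i \<in> S \<Longrightarrow> (\<Sum>k\<in>S. C i k) = s" and col: "\<And>k. k \<in> S \<Longrightarrow> (\<Sum>i\<in>S. C i k) = s"
  shows "p ^ 2 dvd set_det S C"
proof -
  obtain j where j: "j \<in> S" using assms(2) by blast
  define T :: "'a \<Rightarrow> 'a \<Rightarrow> int" where "T i k = of_bool (i = k \<or> k = j)" for i k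
  have S: "insert j (S - {j}) = S" "{j} \<union> (S - {j}) = S" using j by auto
  have T: "set_det S T = 1"
  proof -
    have "set_det (insert j (S - {j})) T = T j j * set_det (S - {j}) T"
      using assms(1) by (intro set_det_insert) (auto simp: T_def)
    also have "set_det (S - {j}) T = 1"
      using assms(1) by (subst set_det_diagonal) (auto simp: T_def)
    also have "T j j = 1" by (simp add: T_def)
    finally show ?thesis by (simp only: S mult_1)
  qed
  have L: "set_det S (\<lambda>i k. T k i) = 1"
  proof -
    have "set_det ({j} \<union> (S - {j})) (\<lambda>i k. T k i) = set_det {j} (\<lambda>i k. T k i)"
      using assms(1) by (intro set_det_identity_off) (auto simp: T_def)
    also have "\<dots> = 1" by (subst set_det_diagonal) (auto simp: T_def)
    finally show ?thesis by (simp only: S)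
  qed
  define N where "N i k = (\<Sum>l\<in>S. T l i * (\<Sum>m\<in>S. C l m * T m k))" for i k
  have det: "set_det S C = set_det S N"
    unfolding N_def using assms(1) by (simp add: set_det_mult T L)
  have Njj: "N j j = int (card S) * s"
    by (simp add: N_def T_def row)
  have Nj: "N j k = s" if "k \<in> S" "k \<noteq> j" for k
    using that assms(1) by (simp add: N_def T_def col)
  have Ni: "N i j = s" if "i \<in> S" "i \<noteq> j" for i
    using that assms(1) by (simp add: N_def T_def row)
  \<comment> \<open>A Leibniz term contains either the entry at \<open>(j, j)\<close>, or one entry
    of row \<open>j\<close> and a different one of column \<open>j\<close>, each a multiple of
    \<open>p\<close>.\<close>
  have "p ^ 2 dvd (\<Prod>i\<in>S. N i (\<sigma> i))" if \<sigma>: "\<sigma> permutes S" for \<sigma>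
  proof (cases "\<sigma> j = j")
    case True
    have "p ^ 2 dvd N j (\<sigma> j)"
      using assms(3,4) by (simp add: True Njj power2_eq_square mult_dvd_mono)
    also have "\<dots> dvd (\<Prod>i\<in>S. N i (\<sigma> i))" using assms(1) j by (rule dvd_prodI)
    finally show ?thesis .
  next
    case False
    obtain i where i: "i \<in> S" "\<sigma> i = j" using j permutes_image[OF \<sigma>] by (metis imageE)
    then have ij: "i \<noteq> j" using False by auto
    have "\<sigma> j \<in> S" using permutes_in_image[OF \<sigma>] j by simp
    then have "p ^ 2 dvd N j (\<sigma> j) * N i (\<sigma> i)"
      using assms(4) False i ij by (simp add: Nj Ni power2_eq_square mult_dvd_mono)
    also have "\<dots> = (\<Prod>l\<in>{i, j}. N l (\<sigma> l))" using ij by simp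
    also have "\<dots> dvd (\<Prod>i\<in>S. N i (\<sigma> i))"
      using assms(1) i j by (intro prod_dvd_prod_subset) auto
    finally show ?thesis .
  qed
  then show ?thesis unfolding det unfolding set_det_def by (intro dvd_sum) (simp add: dvd_mult)
qed

section \<open>Splitting the group determinant\<close>

text \<open>Translation by 1 preserves the sum of all field elements, so \<open>2 ^ k\<close>
  vanishes in the field, and hence so does 2.\<close>

lemma two_eq_zero_of_card:
  assumes "card (UNIV :: 'a::{field,finite} set) = 2 ^ k"
  shows "(2 :: 'a) = 0"
proof -
  have "(\<Sum>x\<in>UNIV. x + 1) = (\<Sum>x\<in>(UNIV :: 'a set). x)"
    by (rule sum.reindex_bij_betw) (auto intro!: bij_betwI[where g = "\<lambda>x. x - 1"])
  then have "of_nat (card (UNIV :: 'a set)) = (0 :: 'a)"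
    by (simp add: sum.distrib)
  then show ?thesis by (simp add: assms)
qed

lemma UNIV_minus_zero: "UNIV - {0} = nz"
  by auto

lemma card_nz: "card (nz :: 'a::{finite,zero} set) = card (UNIV :: 'a set) - 1"
  by (simp add: card_Diff_singleton flip: UNIV_minus_zero)

text \<open>In characteristic two additive characters take only the values 1 and -1, so the Fourier
  analysis stays within the integers. The normalisation at 1 makes the character nontrivial.\<close>

locale sign_character =
  fixes \<psi> :: "'a::{field,finite} \<Rightarrow> int"
  assumes psi_add: "\<psi> (x + y) = \<psi> x * \<psi> y"
    and psi_one: "\<psi> 1 = - 1"
    and double: "(x :: 'a) + x = 0"
begin

lemma psi_zero [simp]: "\<psi> 0 = 1"
  using psi_add[of 1 0] psi_one by simp

lemma psi_sum: "\<psi> (sum f S) = (\<Prod>i\<in>S. \<psi> (f i))"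
  by (induction S rule: infinite_finite_induct) (simp_all add: psi_add)

lemma eq_iff_add_eq_zero: "x + y = 0 \<longleftrightarrow> x = (y :: 'a)"
  by (metis add_left_cancel add.commute double)

lemma uminus_char_two: "- x = (x :: 'a)"
  by (metis double add_eq_0_iff)

text \<open>Orthogonality: for \<open>t \<noteq> 0\<close>, shifting \<open>b\<close> by
  \<open>1 / t\<close> multiplies each term by \<open>\<psi> 1 = - 1\<close>, so the sum is its own
  negative.\<close>

lemma sum_psi: "(\<Sum>b\<in>UNIV. \<psi> (b * t)) = int (card (UNIV :: 'a set)) * of_bool (t = 0)"
proof (cases "t = 0")
  case False
  have "(\<Sum>b\<in>UNIV. \<psi> (b * t)) = (\<Sum>b\<in>UNIV. \<psi> ((b + 1 / t) * t))"
    by (rule sum.reindex_bij_betw[symmetric]) (auto intro!: bij_betwI[where g = "\<lambda>x. x - 1 / t"])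
  also have "\<dots> = - (\<Sum>b\<in>UNIV. \<psi> (b * t))"
    using False by (simp add: distrib_right psi_add psi_one sum_negf)
  finally show ?thesis using False by simp
qed simp

text \<open>The block of the group matrix at the character of parameter \<open>t\<close>. The
  division by \<open>a\<close> reflects the substitution of \<open>(a, a * b)\<close> for
  \<open>(a, b)\<close>; at \<open>t = 0\<close> the block is a circulant.\<close>

definition twist :: "('a \<times> 'a \<Rightarrow> int) \<Rightarrow> 'a \<Rightarrow> 'a \<Rightarrow> 'a \<Rightarrow> int" where
  "twist x t a c = (\<Sum>b\<in>UNIV. x (a / c, b) * \<psi> (t * b / a))"

text \<open>Scaling row and column indices by \<open>t\<close> preserves \<open>a / c\<close> and
  cancels \<open>t\<close> in the character: the nontrivial characters form one orbit under
  \<open>nz\<close>.\<close>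

lemma set_det_twist_nonzero:
  assumes "t \<noteq> 0"
  shows "set_det nz (twist x t) = set_det nz (twist x 1)"
proof -
  have "set_det nz (twist x t) = set_det nz (\<lambda>a c. twist x t (t * a) (t * c))"
    by (rule set_det_reindex[OF bij_betw_mult_nz[OF assms]]) simp
  also have "\<dots> = set_det nz (twist x 1)"
    using assms by (intro set_det_cong) (simp add: twist_def)
  finally show ?thesis .
qed

lemma prod_set_det_twist:
  "(\<Prod>t\<in>UNIV. set_det nz (twist x t)) =
    set_det nz (twist x 0) * set_det nz (twist x 1) ^ card (nz :: 'a set)"
proof -
  have "(\<Prod>t\<in>UNIV. set_det nz (twist x t)) =
      set_det nz (twist x 0) * (\<Prod>t\<in>UNIV - {0}. set_det nz (twist x t))"
    by (rule prod.remove) simp_all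
  also have "UNIV - {0 :: 'a} = nz" by (rule UNIV_minus_zero)
  also have "(\<Prod>t\<in>nz. set_det nz (twist x t)) = (\<Prod>t\<in>(nz :: 'a set). set_det nz (twist x 1))"
    by (rule prod.cong[OF refl], rule set_det_twist_nonzero) simp
  also have "\<dots> = set_det nz (twist x 1) ^ card (nz :: 'a set)"
    by (rule prod_constant)
  finally show ?thesis .
qed

text \<open>After the substitution \<open>(a, b) \<mapsto> (a, a b)\<close> every block of the group matrix is a
  convolution over the additive group, so the matrix \<open>H\<close> of the characters
  \<open>b \<mapsto> \<psi> (b t)\<close> diagonalises all blocks simultaneously.\<close>

lemma group_det_eq_prod_twist:
  "group_det ga_carrier ga_mult ga_inv x = (\<Prod>t\<in>UNIV. set_det nz (twist x t))"
proof -
  let ?G = "(nz :: 'a set) \<times> (UNIV :: 'a set)"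
  let ?q = "int (card (UNIV :: 'a set))"
  define m :: "'a \<times> 'a \<Rightarrow> 'a \<times> 'a" where "m = (\<lambda>(a, b). (a, a * b))"
  define Y where "Y = (\<lambda>(a, b) (c, d). x (a / c, a * (b - d)))"
  define Z where "Z = (\<lambda>(a, s) (c, t). if s = t then twist x s a c else 0)"
  \<comment> \<open>The character table of the additive group, repeated over \<open>nz\<close>. Its
    square is \<open>q\<close> times the identity, so its determinant can be cancelled from
    \<open>Y H = H Z\<close>.\<close>
  define H :: "'a \<times> 'a \<Rightarrow> 'a \<times> 'a \<Rightarrow> int" where
    "H = (\<lambda>(a, b) (c, d). of_bool (a = c) * \<psi> (b * d))"
  have G: "ga_carrier = ?G" by (auto simp: ga_carrier_def)
  have "group_det ga_carrier ga_mult ga_inv x = set_det ?G (\<lambda>g h. x (ga_mult g (ga_inv h)))"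
    by (simp add: group_det_def set_det_def G)
  also have "\<dots> = set_det ?G (\<lambda>g h. x (ga_mult (m g) (ga_inv (m h))))"
    by (rule set_det_reindex)
       (auto simp: m_def intro!: bij_betwI[where g = "\<lambda>(a, b). (a, b / a)"])
  also have "\<dots> = set_det ?G Y"
    by (rule set_det_cong) (auto simp: m_def Y_def ga_mult_def ga_inv_def field_simps)
  finally have det: "group_det ga_carrier ga_mult ga_inv x = set_det ?G Y" .
  have sumG: "(\<Sum>g\<in>?G. F g) = (\<Sum>a\<in>nz. \<Sum>b\<in>UNIV. F (a, b))" for F :: "_ \<Rightarrow> int"
    by (simp add: sum.cartesian_product)
  have "set_det ?G (\<lambda>g h. \<Sum>l\<in>?G. H g l * H l h) = set_det ?G (\<lambda>g h. ?q * of_bool (g = h))"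
  proof (rule set_det_cong)
    fix g h assume "g \<in> ?G" "h \<in> ?G"
    then obtain a b c d where gh: "g = (a, b)" "h = (c, d)" "a \<noteq> 0" "c \<noteq> 0" by auto
    have "(\<Sum>l\<in>?G. H g l * H l h) =
        (\<Sum>a'\<in>nz. of_bool (a = a') * of_bool (a' = c) * (\<Sum>b'\<in>UNIV. \<psi> (b' * (b + d))))"
      unfolding sumG
      by (simp add: H_def gh sum_distrib_left distrib_left psi_add ac_simps)
    also have "\<dots> = of_bool (a = c) * (\<Sum>b'\<in>UNIV. \<psi> (b' * (b + d)))"
      using gh by (simp add: mult.assoc)
    also have "\<dots> = ?q * of_bool (g = h)"
      by (simp add: sum_psi eq_iff_add_eq_zero gh)
    finally show "(\<Sum>l\<in>?G. H g l * H l h) = ?q * of_bool (g = h)" .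
  qed
  also have "\<dots> = ?q ^ card ?G"
    by (subst set_det_diagonal) auto
  finally have "set_det ?G H * set_det ?G H = ?q ^ card ?G"
    by (simp add: set_det_mult)
  moreover have "?q ^ card ?G \<noteq> 0" by simp
  ultimately have H: "set_det ?G H \<noteq> 0" by auto
  have "set_det ?G Y * set_det ?G H = set_det ?G (\<lambda>g h. \<Sum>l\<in>?G. Y g l * H l h)"
    by (simp add: set_det_mult)
  also have "\<dots> = set_det ?G (\<lambda>g h. \<Sum>l\<in>?G. H g l * Z l h)"
  proof (rule set_det_cong)
    fix g h assume "g \<in> ?G" "h \<in> ?G"
    then obtain a b c t where gh: "g = (a, b)" "h = (c, t)" "a \<noteq> 0" "c \<noteq> 0" by auto
    have "(\<Sum>l\<in>?G. Y g l * H l h) =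
        (\<Sum>c'\<in>nz. of_bool (c' = c) * (\<Sum>d\<in>UNIV. x (a / c', a * (b - d)) * \<psi> (d * t)))"
      unfolding sumG by (simp add: Y_def H_def gh sum_distrib_left ac_simps)
    also have "\<dots> = (\<Sum>d\<in>UNIV. x (a / c, a * (b - d)) * \<psi> (d * t))"
      using gh by simp
    \<comment> \<open>The substitution \<open>d = b - e / a\<close> makes the second coordinate
      \<open>e\<close> and splits off \<open>\<psi> (b * t)\<close>.\<close>
    also have "\<dots> = (\<Sum>e\<in>UNIV. x (a / c, a * (b - (b - e / a))) * \<psi> ((b - e / a) * t))"
      by (rule sum.reindex_bij_betw[symmetric])
         (use gh in \<open>auto intro!: bij_betwI[where g = "\<lambda>d. a * (b - d)"] simp: field_simps\<close>)
    also have "\<dots> = (\<Sum>e\<in>UNIV. \<psi> (b * t) * (x (a / c, e) * \<psi> (t * e / a)))"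
    proof (rule sum.cong[OF refl])
      fix e :: 'a
      have "\<psi> ((b - e / a) * t) = \<psi> (b * t + - (e / a * t))" by (simp add: algebra_simps)
      also have "\<dots> = \<psi> (b * t) * \<psi> (t * e / a)" by (simp add: uminus_char_two psi_add ac_simps)
      finally show "x (a / c, a * (b - (b - e / a))) * \<psi> ((b - e / a) * t) =
          \<psi> (b * t) * (x (a / c, e) * \<psi> (t * e / a))"
        using gh by simp
    qed
    also have "\<dots> = \<psi> (b * t) * twist x t a c"
      by (simp add: twist_def sum_distrib_left)
    also have "\<dots> = (\<Sum>a'\<in>nz. of_bool (a = a') * (\<Sum>s\<in>UNIV. of_bool (s = t) * (\<psi> (b * s) * twist x s a' c)))"
      using gh by simp
    also have "\<dots> = (\<Sum>l\<in>?G. H g l * Z l h)"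
      unfolding sumG sum_distrib_left
      by (intro sum.cong refl) (auto simp: H_def Z_def gh)
    finally show "(\<Sum>l\<in>?G. Y g l * H l h) = (\<Sum>l\<in>?G. H g l * Z l h)" .
  qed
  also have "\<dots> = set_det ?G H * set_det ?G Z"
    by (simp add: set_det_mult)
  also have "set_det ?G Z = (\<Prod>t\<in>UNIV. set_det nz (twist x t))"
    unfolding Z_def by (rule set_det_block_diagonal) auto
  finally show ?thesis using H det by simp
qed

text \<open>Summing the Leibniz expansions over all \<open>t\<close>, orthogonality makes every
  coefficient either \<open>0\<close> or \<open>q\<close>.\<close>

lemma twist_dets_cong:
  "[set_det nz (twist x 1) = set_det nz (twist x 0)] (mod int (card (UNIV :: 'a set)))"
proof -
  let ?q = "int (card (UNIV :: 'a set))"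
  let ?X = "\<lambda>\<sigma> h. \<Prod>a\<in>nz. x (a / \<sigma> a, h a)"
  have "set_det nz (twist x t) = (\<Sum>\<sigma> | \<sigma> permutes nz. \<Sum>h\<in>nz \<rightarrow>\<^sub>E UNIV.
      sign \<sigma> * ?X \<sigma> h * \<psi> (t * (\<Sum>a\<in>nz. h a / a)))" for t
  proof -
    \<comment> \<open>Choosing the summand \<open>b = h a\<close> in each row \<open>a\<close>
      expands the product of sums into a sum over functions \<open>h\<close>.\<close>
    have "(\<Prod>a\<in>nz. twist x t a (\<sigma> a)) =
        (\<Sum>h\<in>nz \<rightarrow>\<^sub>E UNIV. ?X \<sigma> h * \<psi> (t * (\<Sum>a\<in>nz. h a / a)))" for \<sigma>
      unfolding twist_def
      by (subst prod_sum_PiE) (simp_all add: prod.distrib psi_sum sum_distrib_left)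
    then show ?thesis by (simp add: set_det_def sum_distrib_left mult.assoc)
  qed
  then have "(\<Sum>t\<in>UNIV. set_det nz (twist x t)) = (\<Sum>\<sigma> | \<sigma> permutes nz. \<Sum>h\<in>nz \<rightarrow>\<^sub>E UNIV.
      \<Sum>t\<in>UNIV. sign \<sigma> * ?X \<sigma> h * \<psi> (t * (\<Sum>a\<in>nz. h a / a)))"
    by (simp add: sum.swap[of _ _ "UNIV :: 'a set"])
  also have "\<dots> = (\<Sum>\<sigma> | \<sigma> permutes nz. \<Sum>h\<in>nz \<rightarrow>\<^sub>E UNIV.
      sign \<sigma> * ?X \<sigma> h * (?q * of_bool ((\<Sum>a\<in>nz. h a / a) = 0)))"
    by (simp only: sum_distrib_left[symmetric] sum_psi)
  also have "?q dvd \<dots>"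
    by (intro dvd_sum, rule dvd_mult, rule dvd_triv_left)
  finally have "?q dvd (\<Sum>t\<in>UNIV. set_det nz (twist x t))" .
  also have "(\<Sum>t\<in>UNIV. set_det nz (twist x t)) =
      set_det nz (twist x 0) + (\<Sum>t\<in>UNIV - {0}. set_det nz (twist x t))"
    by (rule sum.remove) simp_all
  also have "UNIV - {0 :: 'a} = nz" by (rule UNIV_minus_zero)
  also have "(\<Sum>t\<in>nz. set_det nz (twist x t)) = int (card (nz :: 'a set)) * set_det nz (twist x 1)"
  proof -
    have "(\<Sum>t\<in>nz. set_det nz (twist x t)) = (\<Sum>t\<in>(nz :: 'a set). set_det nz (twist x 1))"
      by (rule sum.cong[OF refl], rule set_det_twist_nonzero) simp
    then show ?thesis by (simp only: sum_constant)
  qed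
  also have "int (card (nz :: 'a set)) = ?q - 1"
  proof -
    have "0 < card (UNIV :: 'a set)" by (simp add: card_gt_0_iff)
    then show ?thesis unfolding card_nz by linarith
  qed
  \<comment> \<open>With \<open>A\<close> and \<open>B\<close> the determinants at
    \<open>t = 0\<close> and \<open>t = 1\<close>, the sum \<open>A + (q - 1) B\<close> equals
    \<open>q B - (B - A)\<close>.\<close>
  finally have "?q dvd ?q * set_det nz (twist x 1) - (set_det nz (twist x 1) - set_det nz (twist x 0))"
    by (simp add: algebra_simps)
  then show ?thesis
    by (simp add: cong_iff_dvd_diff dvd_diff_right_iff)
qed

text \<open>Fourier inversion: this element of the group ring twists to the circulant matrix of
  \<open>f\<close> for \<open>t = 0\<close>, and to a perturbation by \<open>q\<close> times a rank one matrix for \<open>t = 1\<close>.\<close>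

lemma twist_rank_one:
  fixes f u :: "'a \<Rightarrow> int" and n :: int
  assumes "j \<noteq> 0" "a \<noteq> 0" "c \<noteq> 0"
  defines "x \<equiv> \<lambda>(e, b). f e * of_bool (b = 0) + n * u (e * j) * \<psi> (b / (e * j))"
  shows "twist x t a c = f (a / c) + int (card (UNIV :: 'a set)) * n * u (a / c * j) * of_bool (c = t * j)"
proof -
  \<comment> \<open>The two characters of \<open>b\<close> cancel exactly when their parameters
    agree, since addition is subtraction here. For \<open>t = 0\<close> this never happens because
    \<open>c\<close> is nonzero.\<close>
  have "c / (a * j) + t / a = 0 \<longleftrightarrow> c = t * j"
    using assms by (simp add: eq_iff_add_eq_zero field_simps)
  moreover have "\<psi> (b / (a / c * j)) * \<psi> (t * b / a) = \<psi> (b * (c / (a * j) + t / a))" for b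
    using assms by (simp add: distrib_left ac_simps flip: psi_add)
  then have "twist x t a c = (\<Sum>b\<in>UNIV. of_bool (b = 0) * (f (a / c) * \<psi> (t * b / a)) +
      n * u (a / c * j) * \<psi> (b * (c / (a * j) + t / a)))"
    by (auto simp: twist_def x_def distrib_right mult.assoc intro!: sum.cong)
  then have "twist x t a c = (\<Sum>b\<in>UNIV. of_bool (b = 0) * (f (a / c) * \<psi> (t * b / a))) +
      n * u (a / c * j) * (\<Sum>b\<in>UNIV. \<psi> (b * (c / (a * j) + t / a)))"
    by (simp only: sum.distrib sum_distrib_left)
  ultimately show ?thesis
    by (simp add: sum_psi)
qed

end

text \<open>The kernel of the character is a maximal additive subgroup among those avoiding \<open>1\<close>.\<close>

lemma exists_sign_character:
  assumes "(2 :: 'a::{field,finite}) = 0"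
  shows "\<exists>\<psi> :: 'a \<Rightarrow> int. sign_character \<psi>"
proof -
  have double: "x + x = 0" for x :: 'a
    using assms by (simp flip: mult_2)
  define P where "P = (\<lambda>U :: 'a set. 0 \<in> U \<and> 1 \<notin> U \<and> (\<forall>x\<in>U. \<forall>y\<in>U. x + y \<in> U))"
  have "P {0}" by (simp add: P_def)
  then have "\<exists>U. P U \<and> (\<forall>V. P V \<longrightarrow> card V \<le> card U)"
    by (rule ex_has_greatest_nat[where b = "Suc (card (UNIV :: 'a set))"])
       (auto simp: less_Suc_eq_le intro: card_mono)
  then obtain U where U: "P U" and max: "\<And>V. P V \<Longrightarrow> card V \<le> card U"
    by blast
  \<comment> \<open>If \<open>x\<close> and \<open>x + 1\<close> both lay outside \<open>U\<close>,
    adjoining the coset of \<open>x\<close> would enlarge \<open>U\<close> and still avoid 1. So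
    \<open>U\<close> has index two.\<close>
  have half: "x + 1 \<in> U" if x: "x \<notin> U" for x
  proof (rule ccontr)
    assume x1: "x + 1 \<notin> U"
    have cancel: "y + x + (z + x) = y + z" for y z
    proof -
      have "y + x + (z + x) = y + z + (x + x)" by (simp only: ac_simps)
      then show ?thesis by (simp add: double)
    qed
    have "P (U \<union> (\<lambda>y. y + x) ` U)"
    proof -
      have "1 \<noteq> y + x" if "y \<in> U" for y
      proof
        assume "1 = y + x"
        then have "x + 1 = x + (y + x)" by (rule arg_cong)
        also have "\<dots> = y + (x + x)" by (simp only: ac_simps)
        finally have "x + 1 = y" by (simp only: double add_0_right)
        then show False using x1 that by simp
      qed
      moreover have "y + (z + x) = (y + z) + x" "y + x + z = (y + z) + x" for y z
        by (simp_all add: algebra_simps)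
      ultimately show ?thesis using U unfolding P_def
        by (auto simp: cancel)
    qed
    then have "card (U \<union> (\<lambda>y. y + x) ` U) \<le> card U" by (rule max)
    then have "U \<union> (\<lambda>y. y + x) ` U = U"
      by (intro sym[OF card_seteq]) auto
    moreover have "0 + x \<in> (\<lambda>y. y + x) ` U" using U unfolding P_def by blast
    ultimately show False using x by auto
  qed
  have add: "x + y \<in> U \<longleftrightarrow> (x \<in> U \<longleftrightarrow> y \<in> U)" for x y
  proof -
    have *: "x + y \<in> U" if "x \<in> U" "y \<in> U" for x y using U that by (simp add: P_def)
    have cancel: "x + (x + y) = y" "y + (x + y) = x" for x y :: 'a
    proof -
      have "x + (x + y) = x + x + y" "y + (x + y) = x + (y + y)"
        by (simp_all only: ac_simps)
      then show "x + (x + y) = y" "y + (x + y) = x" by (simp_all only: double add_0_left add_0_right)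
    qed
    have "x + y \<in> U" if "x \<notin> U" "y \<notin> U"
    proof -
      have "x + 1 + (y + 1) \<in> U" using that by (intro * half)
      also have "x + 1 + (y + 1) = x + y + (1 + 1)" by (simp only: ac_simps)
      finally show ?thesis by (simp only: double add_0_right)
    qed
    then show ?thesis using *[of x "x + y"] *[of y "x + y"] *[of x y] cancel by metis
  qed
  have "sign_character (\<lambda>x. if x \<in> U then 1 else - 1)"
    by unfold_locales (use U double in \<open>auto simp: add P_def\<close>)
  then show ?thesis by blast
qed

section \<open>Prescribing the two factors\<close>

text \<open>\<open>P - I\<close> has zero row and column sums. Adding all columns to column 0 makes
  that column constant \<open>w * r\<close>; factoring through \<open>Q\<close> takes this constant
  out and clears \<open>w\<close> from the other columns. Adding all rows to row 0 then leaves
  \<open>r\<close> times a triangular minor with \<open>r - 1\<close>, an even number, of diagonal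
  entries -1.\<close>

lemma set_det_cyclic_shift:
  fixes w :: int
  assumes "odd r"
  defines "P \<equiv> \<lambda>i j. of_bool (i = (if Suc j = r then 0 else Suc j)) :: int"
  shows "set_det {..<r} (\<lambda>i j. P i j - of_bool (i = j) + w) = w * int r ^ 2"
proof -
  have r: "r > 0" using assms(1) by (cases r) auto
  let ?S = "{..<r}"
  define M where "M = (\<lambda>i j. P i j - of_bool (i = j) + w)"
  define T :: "nat \<Rightarrow> nat \<Rightarrow> int" where "T i j = of_bool (i = j \<or> j = 0)" for i j
  define Q where "Q i j = (if i = 0 then (if j = 0 then w * int r else w) else of_bool (i = j))" for i j :: nat
  define N where "N i j = (if j = 0 then 1 else P i j - of_bool (i = j))" for i j
  have P: "P i j = of_bool (j = (if i = 0 then r - 1 else i - 1))" if "i < r" "j < r" for i j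
    using that by (auto simp: P_def)
  have row: "(\<Sum>j<r. P i j) = 1" if "i < r" for i
  proof -
    have "(\<Sum>j<r. P i j) = (\<Sum>j<r. of_bool (j = (if i = 0 then r - 1 else i - 1)))"
      by (rule sum.cong[OF refl]) (use that in \<open>simp add: P\<close>)
    then show ?thesis using that by simp
  qed
  have col: "(\<Sum>i<r. P i j) = 1" if "j < r" for j
    unfolding P_def using that by simp
  have T: "set_det ?S T = 1"
    by (subst set_det_lower_triangular) (auto simp: T_def)
  have L: "set_det ?S (\<lambda>i j. T j i) = 1"
    by (subst set_det_upper_triangular) (auto simp: T_def)
  have Q: "set_det ?S Q = w * int r"
  proof -
    have "set_det ?S Q = (\<Prod>i<r. Q i i)"
      by (rule set_det_upper_triangular) (auto simp: Q_def)
    also have "\<dots> = (\<Prod>i\<in>{0}. Q i i)"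
      using r by (intro prod.mono_neutral_right) (auto simp: Q_def)
    finally show ?thesis by (simp add: Q_def)
  qed
  have "set_det ?S M * set_det ?S T = set_det ?S (\<lambda>i j. \<Sum>l<r. M i l * T l j)"
    by (simp add: set_det_mult)
  also have "\<dots> = set_det ?S (\<lambda>i j. \<Sum>l<r. N i l * Q l j)"
  proof (rule set_det_cong)
    fix i j assume ij: "i \<in> ?S" "j \<in> ?S"
    have "(\<Sum>l<r. N i l * Q l j) = N i 0 * Q 0 j + (\<Sum>l\<in>?S - {0}. N i l * Q l j)"
      using r by (intro sum.remove) auto
    also have "(\<Sum>l\<in>?S - {0}. N i l * Q l j) = (\<Sum>l\<in>?S - {0}. N i l * of_bool (l = j))"
      by (intro sum.cong) (auto simp: Q_def)
    also have "\<dots> = (if j = 0 then 0 else N i j)"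
      using ij by simp
    finally have NQ: "(\<Sum>l<r. N i l * Q l j) = Q 0 j + (if j = 0 then 0 else N i j)"
      by (simp add: N_def)
    show "(\<Sum>l<r. M i l * T l j) = (\<Sum>l<r. N i l * Q l j)"
    proof (cases "j = 0")
      case True
      have "(\<Sum>l<r. M i l) = w * int r"
        using ij by (simp add: M_def sum.distrib sum_subtractf row)
      then show ?thesis unfolding NQ using True by (simp add: T_def Q_def)
    next
      case False
      then show ?thesis unfolding NQ using ij by (simp add: T_def Q_def N_def M_def)
    qed
  qed
  also have "\<dots> = set_det ?S N * (w * int r)"
    by (simp add: set_det_mult Q)
  finally have M: "set_det ?S M = set_det ?S N * (w * int r)" by (simp add: T)
  have "set_det ?S N = set_det ?S (\<lambda>i j. \<Sum>l<r. T l i * N l j)"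
    by (simp add: set_det_mult L)
  also have "\<dots> = set_det (insert 0 {1..<r}) (\<lambda>i j. \<Sum>l<r. T l i * N l j)"
    using r by (intro arg_cong2[where f = set_det] refl) auto
  also have "\<dots> = (\<Sum>l<r. T l 0 * N l 0) * set_det {1..<r} (\<lambda>i j. \<Sum>l<r. T l i * N l j)"
    by (rule set_det_insert) (auto simp: T_def N_def sum_subtractf col)
  also have "set_det {1..<r} (\<lambda>i j. \<Sum>l<r. T l i * N l j) = set_det {1..<r} N"
    by (rule set_det_cong) (simp add: T_def)
  also have "\<dots> = (\<Prod>i\<in>{1..<r}. N i i)"
    by (rule set_det_lower_triangular) (auto simp: N_def P_def)
  also have "\<dots> = (\<Prod>i\<in>{1..<r}. - 1)"
    by (rule prod.cong) (auto simp: N_def P_def)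
  also have "\<dots> = 1" using assms(1) by simp
  also have "(\<Sum>l<r. T l 0 * N l 0) = int r" by (simp add: T_def N_def)
  finally have "set_det ?S N = int r" by simp
  with M have "set_det ?S M = w * int r ^ 2" by (simp add: power2_eq_square)
  then show ?thesis by (simp only: M_def)
qed

text \<open>On exponents, multiplication by \<open>e\<close> is the cyclic shift, with
  \<open>r - 1\<close> wrapping around to 0.\<close>

lemma power_div_power_eq_iff:
  fixes e :: "'a::{field,finite}"
  defines "r \<equiv> card (nz :: 'a set)"
  assumes "prime r" "e \<noteq> 0" "e \<noteq> 1" "i < r" "j < r"
  shows "e ^ i / e ^ j = e \<longleftrightarrow> i = (if Suc j = r then 0 else Suc j)"
    and "e ^ i = e ^ j \<longleftrightarrow> i = j"
proof -
  have inj: "e ^ m = e ^ n \<longleftrightarrow> m = n" if "m < r" "n < r" for m n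
    using bij_betw_imp_inj_on[OF bij_betw_power_nz[of e]] assms that
    by (auto simp: inj_on_def)
  then show "e ^ i = e ^ j \<longleftrightarrow> i = j" using assms by blast
  define j' where "j' = (if Suc j = r then 0 else Suc j)"
  have j': "j' < r" "e ^ j' = e ^ Suc j"
    using assms power_card_nz[of e] by (auto simp: j'_def r_def simp del: power_Suc)
  have "e ^ i / e ^ j = e \<longleftrightarrow> e ^ i = e ^ j'"
    using assms by (simp add: j'(2) divide_eq_eq)
  also have "\<dots> \<longleftrightarrow> i = j'" using j' assms by (intro inj)
  finally show "e ^ i / e ^ j = e \<longleftrightarrow> i = (if Suc j = r then 0 else Suc j)"
    by (simp only: j'_def)
qed

text \<open>The value does not depend on \<open>e\<close>, which later allows \<open>g\<close> to be
  compared with \<open>g ^ m\<close>.\<close>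

lemma set_det_shift_nz:
  fixes e :: "'a::{field,finite}"
  defines "r \<equiv> card (nz :: 'a set)"
  assumes "prime r" "odd r" "e \<noteq> 0" "e \<noteq> 1"
  shows "set_det nz (\<lambda>a c. of_bool (a / c = e) - of_bool (a = c) + w) = w * int r ^ 2"
proof -
  have "bij_betw (\<lambda>i. e ^ i) {..<r} nz"
    unfolding r_def by (rule bij_betw_power_nz) (use assms in auto)
  then have "set_det nz (\<lambda>a c. of_bool (a / c = e) - of_bool (a = c) + w) =
      set_det {..<r} (\<lambda>i j. of_bool (e ^ i / e ^ j = e) - of_bool (e ^ i = e ^ j) + w)"
    by (rule set_det_reindex) simp
  also have "\<dots> = set_det {..<r} (\<lambda>i j. of_bool (i = (if Suc j = r then 0 else Suc j)) - of_bool (i = j) + w)"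
    by (rule set_det_cong) (use assms in \<open>simp add: power_div_power_eq_iff\<close>)
  also have "\<dots> = w * int r ^ 2"
    by (rule set_det_cyclic_shift[OF assms(3)])
  finally show ?thesis .
qed

lemma sum_div_nz:
  fixes f :: "'a::{field,finite} \<Rightarrow> int"
  assumes "a \<noteq> 0"
  shows "(\<Sum>c\<in>nz. f (a / c)) = sum f nz" "(\<Sum>c\<in>nz. f (c / a)) = sum f nz"
proof -
  show "(\<Sum>c\<in>nz. f (a / c)) = sum f nz"
    by (rule sum.reindex_bij_betw) (auto intro!: bij_betwI[where g = "\<lambda>c. a / c"] simp: assms)
  show "(\<Sum>c\<in>nz. f (c / a)) = sum f nz"
    by (rule sum.reindex_bij_betw) (auto intro!: bij_betwI[where g = "\<lambda>c. c * a"] simp: assms)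
qed

text \<open>The group ring identity
  \<open>(x - 1 + N) (1 + x + \<dots> + x\<^sup>m\<^sup>-\<^sup>1 + h N) = x\<^sup>m - 1 + (m + h r) N\<close>, with \<open>N\<close> the sum of
  all group elements, reduces the determinant to two instances of \<open>set_det_shift_nz\<close>.\<close>

lemma set_det_geometric_nz:
  fixes g :: "'a::{field,finite}" and h :: int and m :: nat
  defines "r \<equiv> card (nz :: 'a set)" and "f \<equiv> \<lambda>e. (\<Sum>i<m. of_bool (e = g ^ i)) + h"
  assumes "prime r" "odd r" "g \<noteq> 0" "g \<noteq> 1" "0 < m" "m < r"
  shows "set_det nz (\<lambda>a c. f (a / c)) = int m + h * int r"
    and "sum f nz = int m + h * int r"
proof -
  let ?A = "int m + h * int r"
  have "(\<Sum>e\<in>nz. \<Sum>i<m. of_bool (e = g ^ i)) = (\<Sum>i<m. \<Sum>e\<in>nz. of_bool (e = g ^ i) :: int)"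
    by (rule sum.swap)
  also have "\<dots> = int m" using assms by simp
  finally show s: "sum f nz = ?A" by (simp add: f_def sum.distrib r_def)
  \<comment> \<open>Hence \<open>g ^ m\<close> is again a generator and
    \<open>set_det_shift_nz\<close> also covers the right side of the identity.\<close>
  have gm: "g ^ m \<noteq> 1"
    using power_div_power_eq_iff(2)[of g m 0] assms by auto
  let ?K = "\<lambda>a c. of_bool (a / c = g) - of_bool (a = c) + 1 :: int"
  have "int r ^ 2 * set_det nz (\<lambda>a c. f (a / c)) = set_det nz ?K * set_det nz (\<lambda>a c. f (a / c))"
    using assms by (simp add: set_det_shift_nz)
  also have "\<dots> = set_det nz (\<lambda>a d. \<Sum>c\<in>nz. ?K a c * f (c / d))"
    by (simp add: set_det_mult)
  also have "\<dots> = set_det nz (\<lambda>a d. of_bool (a / d = g ^ m) - of_bool (a = d) + ?A)"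
  proof (rule set_det_cong)
    fix a d :: 'a assume "a \<in> nz" "d \<in> nz"
    then have ad: "a \<noteq> 0" "d \<noteq> 0" by auto
    have "(\<Sum>c\<in>nz. ?K a c * f (c / d)) =
        (\<Sum>c\<in>nz. of_bool (c = a / g) * f (c / d) - of_bool (c = a) * f (c / d) + f (c / d))"
      using assms(5) ad by (intro sum.cong) (auto simp: field_simps)
    also have "\<dots> = f (a / g / d) - f (a / d) + (\<Sum>c\<in>nz. f (c / d))"
      using assms(5) ad by (simp add: sum.distrib sum_subtractf)
    also have "(\<Sum>c\<in>nz. f (c / d)) = ?A" using ad s by (simp add: sum_div_nz)
    also have "f (a / g / d) - f (a / d) =
        (\<Sum>i<m. of_bool (a / d = g ^ Suc i) - of_bool (a / d = g ^ i))"
      using assms(5) ad by (simp add: f_def sum_subtractf field_simps)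
    also have "\<dots> = of_bool (a / d = g ^ m) - of_bool (a / d = g ^ 0)"
      by (rule sum_lessThan_telescope)
    finally show "(\<Sum>c\<in>nz. ?K a c * f (c / d)) = of_bool (a / d = g ^ m) - of_bool (a = d) + ?A"
      using ad by simp
  qed
  also have "\<dots> = ?A * int r ^ 2"
    unfolding r_def by (rule set_det_shift_nz) (use assms gm in auto)
  finally show "set_det nz (\<lambda>a c. f (a / c)) = ?A"
    using assms(7,8) by simp
qed

text \<open>In both cases \<open>y / A\<close> is a column of the inverse circulant (for the first case, the sum
  of all of them). For \<open>f = x - 1 + m N\<close> that inverse is
  \<open>(\<Sum>i. i x\<^sup>i) / r + N / (m r\<^sup>2) - (r - 1) N / (2 r)\<close>.\<close>

lemma exists_circulant:
  fixes A :: int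
  defines "r \<equiv> card (nz :: 'a::{field,finite} set)"
  assumes "prime r" "odd r" "\<not> int r dvd A \<or> int r ^ 2 dvd A"
  shows "\<exists>(f :: 'a \<Rightarrow> int) y u j. j \<noteq> 0 \<and> set_det nz (\<lambda>a c. f (a / c)) = A \<and>
    (\<forall>a\<in>nz. (\<Sum>c\<in>nz. f (a / c) * y c) = A * u a) \<and> y j = 1"
proof -
  have "card (nz :: 'a set) \<noteq> card {1 :: 'a}" using assms(2) not_prime_1 unfolding r_def by auto
  then have "nz \<noteq> {1 :: 'a}" by metis
  then obtain g :: 'a where g: "g \<noteq> 0" "g \<noteq> 1" by auto
  have r: "r > 0" using assms(2) prime_gt_0_nat by blast
  show ?thesis
  proof (cases "int r dvd A")
    case False
    \<comment> \<open>Division with remainder writes \<open>A\<close> as \<open>m + h r\<close>,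
      with \<open>m\<close> nonzero because \<open>r\<close> does not divide
      \<open>A\<close>.\<close>
    define m where "m = nat (A mod int r)"
    define f where "f = (\<lambda>e :: 'a. (\<Sum>i<m. of_bool (e = g ^ i)) + A div int r)"
    have "A mod int r > 0"
      using False r by (simp add: dvd_eq_mod_eq_0 order.not_eq_order_implies_strict)
    then have m: "int m = A mod int r" "0 < m" by (auto simp: m_def)
    have "int m < int r" using r by (simp add: m)
    then have "m < r" by simp
    then have "set_det nz (\<lambda>a c. f (a / c)) = int m + A div int r * int r"
      "sum f nz = int m + A div int r * int r"
      using set_det_geometric_nz[of g m "A div int r"] assms g m unfolding f_def r_def by auto
    then have "set_det nz (\<lambda>a c. f (a / c)) = A" "sum f nz = A"
      by (simp_all add: m)
    \<comment> \<open>All row sums equal \<open>A\<close>, so \<open>y\<close> and \<open>u\<close>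
      can be constant 1 and any column can serve as \<open>j\<close>.\<close>
    then show ?thesis
      by (intro exI[of _ f] exI[of _ "\<lambda>_. 1"] exI[of _ 1]) (simp add: sum_div_nz)
  next
    case True
    then obtain m where m: "A = int r ^ 2 * m" using assms(4) by auto
    obtain h where h: "r = 2 * h + 1" using assms(3) by (elim oddE)
    define f :: "'a \<Rightarrow> int" where "f e = of_bool (e = g) - of_bool (e = 1) + m" for e
    \<comment> \<open>\<open>Y\<close> is linear in the exponent, so the shift difference
      \<open>- m r\<close> cancels \<open>m\<close> times the sum of \<open>Y\<close>, except at the
      wrap-around, where \<open>m r ^ 2 = A\<close> remains. Centring at
      \<open>h = (r - 1) / 2\<close> gives \<open>Y\<close> the sum \<open>r\<close> and the value 1
      at \<open>h\<close>, whence \<open>j = g ^ h\<close>.\<close>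
    define Y where "Y i = m * int r * (int i - int h) + 1" for i
    have bij: "bij_betw (\<lambda>i. g ^ i) {..<r} nz"
      unfolding r_def by (rule bij_betw_power_nz) (use assms g in auto)
    define y where "y c = Y (inv_into {..<r} (\<lambda>i. g ^ i) c)" for c
    have y: "y (g ^ i) = Y i" if "i < r" for i
      using bij_betw_inv_into_left[OF bij, of i] that by (simp add: y_def)
    have "set_det nz (\<lambda>a c. f (a / c)) = set_det nz (\<lambda>a c. of_bool (a / c = g) - of_bool (a = c) + m)"
      by (rule set_det_cong) (auto simp: f_def)
    then have det: "set_det nz (\<lambda>a c. f (a / c)) = A"
      using assms g by (simp add: set_det_shift_nz m r_def)
    have "(\<Sum>i<n. 2 * int i) = int n * (int n - 1)" for n
      by (induction n) (auto simp: algebra_simps)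
    from this[of r] have "2 * (\<Sum>i<r. int i) = 2 * (int r * int h)"
      by (simp add: sum_distrib_left h)
    then have sumY: "(\<Sum>i<r. Y i) = int r"
      by (simp add: Y_def sum.distrib sum_subtractf flip: sum_distrib_left)
    have lin: "(\<Sum>c\<in>nz. f (a / c) * y c) = A * of_bool (a = 1)" if "a \<in> nz" for a
    proof -
      obtain n where n: "n < r" "a = g ^ n"
        using \<open>a \<in> nz\<close> bij_betw_imp_surj_on[OF bij] by blast
      define p where "p = (if n = 0 then r - 1 else n - 1)"
      have "(\<Sum>c\<in>nz. f (a / c) * y c) = (\<Sum>i<r. f (a / g ^ i) * y (g ^ i))"
        by (rule sum.reindex_bij_betw[OF bij, symmetric])
      also have "\<dots> = (\<Sum>i<r. of_bool (i = p) * Y i - of_bool (i = n) * Y i + m * Y i)"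
      proof (rule sum.cong[OF refl])
        fix i assume "i \<in> {..<r}"
        then have i: "i < r" by simp
        have "a / g ^ i = g \<longleftrightarrow> n = (if Suc i = r then 0 else Suc i)"
          unfolding n r_def by (rule power_div_power_eq_iff) (use assms g n i in auto)
        also have "\<dots> \<longleftrightarrow> i = p" using i n r by (auto simp: p_def)
        finally have 1: "a / g ^ i = g \<longleftrightarrow> i = p" .
        have "a / g ^ i = 1 \<longleftrightarrow> g ^ n = g ^ i" using g by (simp add: n)
        also have "\<dots> \<longleftrightarrow> n = i"
          by (rule power_div_power_eq_iff) (use assms g n i in auto)
        finally have 2: "a / g ^ i = 1 \<longleftrightarrow> i = n" by auto
        show "f (a / g ^ i) * y (g ^ i) = of_bool (i = p) * Y i - of_bool (i = n) * Y i + m * Y i"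
          unfolding f_def 1 2 y[OF i] by (simp add: algebra_simps)
      qed
      also have "\<dots> = Y p - Y n + m * int r"
        using n by (simp add: sum.distrib sum_subtractf sumY p_def flip: sum_distrib_left)
      also have "\<dots> = A * of_bool (n = 0)"
        using r by (auto simp: Y_def p_def m algebra_simps power2_eq_square of_nat_diff)
      also have "n = 0 \<longleftrightarrow> a = 1"
        using power_div_power_eq_iff(2)[of g n 0] assms g n r by (simp add: r_def)
      finally show ?thesis .
    qed
    have "y (g ^ h) = 1" using h by (subst y) (auto simp: Y_def)
    then show ?thesis using g det lin
      by (intro exI[of _ f] exI[of _ y] exI[of _ "\<lambda>a. of_bool (a = 1)"] exI[of _ "g ^ h"]) simp
  qed
qed

section \<open>Both inclusions for \<open>GA(1, q)\<close>: necessity, then realisation\<close>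

theorem theorem4:
  fixes k :: nat
  assumes "k \<ge> 2"
    and "prime ((2::int) ^ k - 1)"
    and "card (UNIV :: 'a set) = 2 ^ k"
  shows "ga_int_group_dets TYPE('a::{finite,field}) =
     {D. \<exists>A B :: int. D = A * B ^ (2 ^ k - 1) \<and>
          (\<not> (2 ^ k - 1) dvd A \<or> (2 ^ k - 1) ^ 2 dvd A) \<and>
          [B = A] (mod 2 ^ k)}"
proof -
  let ?r = "card (nz :: 'a set)"
  have card: "?r = 2 ^ k - 1" by (simp add: card_nz assms(3))
  have q: "int (card (UNIV :: 'a set)) = 2 ^ k" by (simp add: assms(3))
  have r: "int ?r = 2 ^ k - 1" by (simp add: card of_nat_diff)
  have prime: "prime ?r" using assms(2) by (simp flip: r)
  have odd: "odd ?r" using assms(1) by (simp add: card)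
  obtain \<psi> :: "'a \<Rightarrow> int" where "sign_character \<psi>"
    using exists_sign_character two_eq_zero_of_card[OF assms(3)] by blast
  then interpret sign_character \<psi> .
  have det: "group_det (ga_carrier :: ('a \<times> 'a) set) ga_mult ga_inv x =
      set_det nz (twist x 0) * set_det nz (twist x 1) ^ ?r" for x
    by (simp only: group_det_eq_prod_twist prod_set_det_twist)
  show ?thesis
  proof (intro equalityI subsetI)
    fix D assume "D \<in> ga_int_group_dets TYPE('a)"
    then obtain x :: "'a \<times> 'a \<Rightarrow> int" where x: "D = group_det ga_carrier ga_mult ga_inv x"
      by (auto simp: ga_int_group_dets_def)
    define f where "f e = (\<Sum>b\<in>UNIV. x (e, b))" for e
    have tw: "twist x 0 = (\<lambda>a c. f (a / c))"
      by (simp add: twist_def f_def fun_eq_iff)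
    have "int ?r ^ 2 dvd set_det nz (twist x 0)" if "int ?r dvd set_det nz (twist x 0)"
    proof -
      have "int ?r dvd sum f nz"
        using that set_det_circulant_cong[OF prime odd, of f] by (simp add: tw cong_dvd_iff)
      then show ?thesis unfolding tw
        by (intro square_dvd_set_det[where s = "sum f nz"]) (auto simp: sum_div_nz intro: exI[of _ 1])
    qed
    then show "D \<in> {D. \<exists>A B :: int. D = A * B ^ (2 ^ k - 1) \<and>
          (\<not> (2 ^ k - 1) dvd A \<or> (2 ^ k - 1) ^ 2 dvd A) \<and> [B = A] (mod 2 ^ k)}"
      using x det[of x] twist_dets_cong[of x] unfolding q r unfolding card by blast
  next
    fix D assume "D \<in> {D. \<exists>A B :: int. D = A * B ^ (2 ^ k - 1) \<and>
          (\<not> (2 ^ k - 1) dvd A \<or> (2 ^ k - 1) ^ 2 dvd A) \<and> [B = A] (mod 2 ^ k)}"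
    then obtain A B :: int where D: "D = A * B ^ ?r"
      and A: "\<not> int ?r dvd A \<or> int ?r ^ 2 dvd A" and B: "[B = A] (mod 2 ^ k)"
      unfolding r unfolding card by blast
    have "\<exists>x. D = group_det (ga_carrier :: ('a \<times> 'a) set) ga_mult ga_inv x"
    \<comment> \<open>The rank one update divides by \<open>A\<close>; for \<open>A = 0\<close> the
      determinant \<open>D\<close> is 0, attained by the zero element.\<close>
    proof (cases "A = 0")
      case True
      have "(1, 0) \<in> (ga_carrier :: ('a \<times> 'a) set)" by (simp add: ga_carrier_def)
      then have zero: "(0 :: int) ^ card (ga_carrier :: ('a \<times> 'a) set) = 0"
        by (auto simp: power_0_left)
      have "group_det (ga_carrier :: ('a \<times> 'a) set) ga_mult ga_inv (\<lambda>_. 0) = 0"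
        by (simp only: group_det_def prod_constant zero mult_zero_right sum.neutral_const)
      then show ?thesis using True D by (intro exI[of _ "\<lambda>_. 0"]) simp
    next
      case False
      obtain f :: "'a \<Rightarrow> int" and y u j where j: "j \<noteq> 0" and f: "set_det nz (\<lambda>a c. f (a / c)) = A"
        and y: "\<And>a. a \<in> nz \<Longrightarrow> (\<Sum>c\<in>nz. f (a / c) * y c) = A * u a" "y j = 1"
        using exists_circulant[OF prime odd A] by blast
      obtain n where n: "B = A + 2 ^ k * n"
        using B by (metis cong_iff_lin cong_sym)
      define x where "x = (\<lambda>(e, b). f e * of_bool (b = 0) + n * u (e * j) * \<psi> (b / (e * j)))"
      note tw = twist_rank_one[OF j, of _ _ f n u, folded x_def]
      \<comment> \<open>At \<open>t = 0\<close> the perturbed column would be \<open>c = 0\<close>,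
        which is not in \<open>nz\<close>; at \<open>t = 1\<close> it is column
        \<open>j\<close>.\<close>
      have "set_det nz (twist x 0) = set_det nz (\<lambda>a c. f (a / c))"
        by (rule set_det_cong) (simp add: tw)
      moreover have "set_det nz (twist x 1) =
          set_det nz (\<lambda>a c. f (a / c) + 2 ^ k * n * u a * of_bool (c = j))"
        by (rule set_det_cong) (auto simp: tw q)
      moreover have "\<dots> = A + 2 ^ k * n"
        by (rule set_det_add_rank_one[where y = y]) (use j f y False in auto)
      ultimately have "D = group_det ga_carrier ga_mult ga_inv x"
        using D det[of x] n f by simp
      then show ?thesis by blast
    qed
    then show "D \<in> ga_int_group_dets TYPE('a)"
      by (auto simp: ga_int_group_dets_def)
  qed
qed

end
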